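(* Let $Y_0,Y_1\in\{0,1\}$ be the potential outcomes and $X$ the set of features, and let $(y_0,y_1)\in\{0,1\}^2$. As the conditional entropy $H(Y_0,Y_1\mid X)$ approaches zero, the uplift bounds on the probability $P(Y_0=y_0,Y_1=y_1)$ collapse to the exact value of that probability. Conversely, as the conditional entropy $H(Y_0,Y_1\mid X)$ approaches the entropy $H(Y_0,Y_1)$, the uplift bounds on $P(Y_0=y_0,Y_1=y_1)$ reduce to the Fréchet bounds on that probability.
   Context: $T\in\{0,1\}$ is a binary treatment, $Y\in\{0,1\}$ a binary outcome, and $Y_t$ (for $t=0,1$) denotes the outcome under the intervention setting $T=t$. $X$ is a set of features with probability density function $f_X$, not affected by the treatment. Unconfoundedness is assumed: $Y_t\perp T\mid X$ for each $t$. Write $S_t(x)=P(Y_t=1\mid X=x)$ and $S_t=P(Y_t=1)=\mathbb{E}_X[S_t(X)]$ for $t=0,1$, and $\alpha=P(Y_0=0,Y_1=0)$, $\beta=P(Y_0=1,Y_1=0)$, $\gamma=P(Y_0=0,Y_1=1)$, $\delta=P(Y_0=1,Y_1=1)$. The uplift bounds on these four probabilities are (expectations over $X$): $\mathbb{E}[\max\{0,1-S_0(X)-S_1(X)\}]\le\alpha\le\mathbb{E}[\min\{1-S_0(X),1-S_1(X)\}]$; $\mathbb{E}[\max\{0,S_0(X)-S_1(X)\}]\le\beta\le\mathbb{E}[\min\{S_0(X),1-S_1(X)\}]$; $\mathbb{E}[\max\{0,S_1(X)-S_0(X)\}]\le\gamma\le\mathbb{E}[\min\{1-S_0(X),S_1(X)\}]$;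 $\mathbb{E}[\max\{0,S_0(X)+S_1(X)-1\}]\le\delta\le\mathbb{E}[\min\{S_0(X),S_1(X)\}]$. The Fréchet bounds on these four probabilities are: $\max\{0,1-S_0-S_1\}\le\alpha\le\min\{1-S_0,1-S_1\}$; $\max\{0,S_0-S_1\}\le\beta\le\min\{S_0,1-S_1\}$; $\max\{0,S_1-S_0\}\le\gamma\le\min\{1-S_0,S_1\}$; $\max\{0,S_0+S_1-1\}\le\delta\le\min\{S_0,S_1\}$. $H(Y_0,Y_1)$ is the Shannon entropy of the pair $(Y_0,Y_1)$, and the conditional entropy is $H(Y_0,Y_1\mid X)=-\int\sum_{y_0,y_1}P(y_0,y_1\mid x)\log P(y_0,y_1\mid x)\,f_X(x)\,dx$, where the sum runs over the four possible values of $(Y_0,Y_1)$ and $P(y_0,y_1\mid x)=P(Y_0=y_0,Y_1=y_1\mid X=x)$. *)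

theory Defs
  imports "HOL-Probability.Probability"
begin

text \<open>
  Binary variables are \<^typ>\<open>bool\<close>-valued, with \<^const>\<open>True\<close> for the value 1, so a random
  variable \<open>Q :: 'a \<Rightarrow> bool\<close> also names the event \<open>Q = 1\<close>.

  A version of \<open>x \<mapsto> P(Q | X = x)\<close> is obtained by differentiating the measure
  \<open>B \<mapsto> P(Q, X \<in> B)\<close> with respect to the law of \<open>X\<close>; see the lemma
  \<open>set_integral_cprob\<close> below.
\<close>

definition cprob :: "'a measure \<Rightarrow> 'x measure \<Rightarrow> ('a \<Rightarrow> 'x) \<Rightarrow> ('a \<Rightarrow> bool) \<Rightarrow> 'x \<Rightarrow> real" where
  "cprob M N X Q x =
     enn2real (RN_deriv (distr M N X) (distr (density M (indicator {\<omega> \<in> space M. Q \<omega>})) N X) x)"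

definition cond_indep ::
    "'a measure \<Rightarrow> 'x measure \<Rightarrow> ('a \<Rightarrow> 'x) \<Rightarrow> ('a \<Rightarrow> bool) \<Rightarrow> ('a \<Rightarrow> bool) \<Rightarrow> bool" where
  "cond_indep M N X U V \<longleftrightarrow>
     (\<forall>u v. AE x in distr M N X.
        cprob M N X (\<lambda>\<omega>. U \<omega> = u \<and> V \<omega> = v) x =
        cprob M N X (\<lambda>\<omega>. U \<omega> = u) x * cprob M N X (\<lambda>\<omega>. V \<omega> = v) x)"

text \<open>
  \<open>N\<close> is the reference measure \<open>dx\<close> on the feature space (for real features, \<^const>\<open>lborel\<close>)
  and \<open>f\<close> is the density of \<open>X\<close> with respect to it. The observed outcome \<open>Y\<close> is the potential
  outcome of the treatment \<open>T\<close> actually received.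
\<close>

locale uplift_model = prob_space M + feature: sigma_finite_measure N
  for M :: "'a measure" and N :: "'x measure" +
  fixes X :: "'a \<Rightarrow> 'x" and f :: "'x \<Rightarrow> real" and T Y Y0 Y1 :: "'a \<Rightarrow> bool"
  assumes T_measurable: "T \<in> M \<rightarrow>\<^sub>M count_space UNIV"
    and Y0_measurable: "Y0 \<in> M \<rightarrow>\<^sub>M count_space UNIV"
    and Y1_measurable: "Y1 \<in> M \<rightarrow>\<^sub>M count_space UNIV"
    and X_distributed: "distributed M N X (\<lambda>x. ennreal (f x))"
    and f_nonneg: "\<And>x. x \<in> space N \<Longrightarrow> 0 \<le> f x"
    and consistency: "\<And>\<omega>. \<omega> \<in> space M \<Longrightarrow> Y \<omega> = (if T \<omega> then Y1 \<omega> else Y0 \<omega>)"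
    and unconfounded0: "cond_indep M N X Y0 T"
    and unconfounded1: "cond_indep M N X Y1 T"

definition joint_prob :: "'a measure \<Rightarrow> ('a \<Rightarrow> bool) \<Rightarrow> ('a \<Rightarrow> bool) \<Rightarrow> bool \<Rightarrow> bool \<Rightarrow> real" where
  "joint_prob M Y0 Y1 y0 y1 = measure M {\<omega> \<in> space M. Y0 \<omega> = y0 \<and> Y1 \<omega> = y1}"

text \<open>The Frechet bounds on \<open>P(Y0 = y0, Y1 = y1)\<close> as functions of \<open>s0 = P(Y0 = 1)\<close> and
  \<open>s1 = P(Y1 = 1)\<close>.\<close>

fun frechet_lower :: "bool \<Rightarrow> bool \<Rightarrow> real \<Rightarrow> real \<Rightarrow> real" where
  "frechet_lower False False s0 s1 = max 0 (1 - s0 - s1)"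
| "frechet_lower True False s0 s1 = max 0 (s0 - s1)"
| "frechet_lower False True s0 s1 = max 0 (s1 - s0)"
| "frechet_lower True True s0 s1 = max 0 (s0 + s1 - 1)"

fun frechet_upper :: "bool \<Rightarrow> bool \<Rightarrow> real \<Rightarrow> real \<Rightarrow> real" where
  "frechet_upper False False s0 s1 = min (1 - s0) (1 - s1)"
| "frechet_upper True False s0 s1 = min s0 (1 - s1)"
| "frechet_upper False True s0 s1 = min (1 - s0) s1"
| "frechet_upper True True s0 s1 = min s0 s1"

definition frechet_lower_bound ::
    "'a measure \<Rightarrow> ('a \<Rightarrow> bool) \<Rightarrow> ('a \<Rightarrow> bool) \<Rightarrow> bool \<Rightarrow> bool \<Rightarrow> real" where
  "frechet_lower_bound M Y0 Y1 y0 y1 =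
     frechet_lower y0 y1 (measure M {\<omega> \<in> space M. Y0 \<omega>}) (measure M {\<omega> \<in> space M. Y1 \<omega>})"

definition frechet_upper_bound ::
    "'a measure \<Rightarrow> ('a \<Rightarrow> bool) \<Rightarrow> ('a \<Rightarrow> bool) \<Rightarrow> bool \<Rightarrow> bool \<Rightarrow> real" where
  "frechet_upper_bound M Y0 Y1 y0 y1 =
     frechet_upper y0 y1 (measure M {\<omega> \<in> space M. Y0 \<omega>}) (measure M {\<omega> \<in> space M. Y1 \<omega>})"

definition uplift_lower_bound ::
    "'a measure \<Rightarrow> 'x measure \<Rightarrow> ('a \<Rightarrow> 'x) \<Rightarrow> ('a \<Rightarrow> bool) \<Rightarrow> ('a \<Rightarrow> bool) \<Rightarrow> bool \<Rightarrow> bool \<Rightarrow> real" where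
  "uplift_lower_bound M N X Y0 Y1 y0 y1 =
     (\<integral>\<omega>. frechet_lower y0 y1 (cprob M N X Y0 (X \<omega>)) (cprob M N X Y1 (X \<omega>)) \<partial>M)"

definition uplift_upper_bound ::
    "'a measure \<Rightarrow> 'x measure \<Rightarrow> ('a \<Rightarrow> 'x) \<Rightarrow> ('a \<Rightarrow> bool) \<Rightarrow> ('a \<Rightarrow> bool) \<Rightarrow> bool \<Rightarrow> bool \<Rightarrow> real" where
  "uplift_upper_bound M N X Y0 Y1 y0 y1 =
     (\<integral>\<omega>. frechet_upper y0 y1 (cprob M N X Y0 (X \<omega>)) (cprob M N X Y1 (X \<omega>)) \<partial>M)"

text \<open>\<open>H(Y0, Y1)\<close> and \<open>H(Y0, Y1 | X)\<close>, with logarithms to base \<open>b\<close>. Since \<open>log b 0 = 0\<close>, the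
  convention \<open>0 log 0 = 0\<close> is respected.\<close>

definition outcome_entropy :: "real \<Rightarrow> 'a measure \<Rightarrow> ('a \<Rightarrow> bool) \<Rightarrow> ('a \<Rightarrow> bool) \<Rightarrow> real" where
  "outcome_entropy b M Y0 Y1 = prob_space.entropy M b (count_space UNIV) (\<lambda>\<omega>. (Y0 \<omega>, Y1 \<omega>))"

definition outcome_cond_entropy ::
    "real \<Rightarrow> 'a measure \<Rightarrow> 'x measure \<Rightarrow> ('a \<Rightarrow> 'x) \<Rightarrow> ('x \<Rightarrow> real) \<Rightarrow>
     ('a \<Rightarrow> bool) \<Rightarrow> ('a \<Rightarrow> bool) \<Rightarrow> real" where
  "outcome_cond_entropy b M N X f Y0 Y1 =
     - (\<integral>x. (\<Sum>(y0, y1) \<in> UNIV.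
           cprob M N X (\<lambda>\<omega>. Y0 \<omega> = y0 \<and> Y1 \<omega> = y1) x *
           log b (cprob M N X (\<lambda>\<omega>. Y0 \<omega> = y0 \<and> Y1 \<omega> = y1) x)) * f x \<partial>N)"

lemma (in prob_space) set_integral_cprob:
  assumes [measurable]: "X \<in> M \<rightarrow>\<^sub>M N" "Q \<in> M \<rightarrow>\<^sub>M count_space UNIV" "B \<in> sets N"
  shows "measure M {\<omega> \<in> space M. Q \<omega> \<and> X \<omega> \<in> B} = (\<integral>x\<in>B. cprob M N X Q x \<partial>distr M N X)"
proof -
  define D where "D = distr M N X"
  define E where "E = distr (density M (indicator {\<omega> \<in> space M. Q \<omega>})) N X"
  have EB: "emeasure E C = emeasure M {\<omega> \<in> space M. Q \<omega> \<and> X \<omega> \<in> C}" if [measurable]: "C \<in> sets N" for C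
  proof -
    have "emeasure E C = (\<integral>\<^sup>+\<omega>. indicator {\<omega> \<in> space M. Q \<omega>} \<omega> * indicator (X -` C \<inter> space M) \<omega> \<partial>M)"
      unfolding E_def by (simp add: emeasure_distr emeasure_density)
    also have "\<dots> = (\<integral>\<^sup>+\<omega>. indicator {\<omega> \<in> space M. Q \<omega> \<and> X \<omega> \<in> C} \<omega> \<partial>M)"
      by (intro nn_integral_cong) (auto split: split_indicator)
    finally show ?thesis by simp
  qed
  interpret D: prob_space D unfolding D_def by (rule prob_space_distr) measurable
  have sE: "sets E = sets D" by (simp add: D_def E_def)
  have fin: "finite_measure E"
    by (rule finite_measureI) (use EB[of "space N"] in \<open>simp add: E_def\<close>)
  then interpret E: finite_measure E .
  have ac: "absolutely_continuous D E"
    unfolding absolutely_continuous_def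
  proof (rule subsetI)
    fix C assume "C \<in> null_sets D"
    then have [measurable]: "C \<in> sets N" and "emeasure D C = 0" by (auto simp: D_def null_sets_def)
    moreover have "emeasure E C \<le> emeasure D C"
      unfolding EB[OF \<open>C \<in> sets N\<close>] by (simp add: D_def emeasure_distr) (auto intro!: emeasure_mono)
    ultimately show "C \<in> null_sets E" by (auto simp: null_sets_def E_def)
  qed
  have "(\<integral>x. indicator B x \<partial>E) = (\<integral>x. enn2real (RN_deriv D E x) * indicator B x \<partial>D)"
    by (rule D.RN_deriv_integral[OF E.sigma_finite_measure_axioms ac sE]) (simp add: D_def)
  moreover have "(\<integral>x. indicator B x \<partial>E) = measure M {\<omega> \<in> space M. Q \<omega> \<and> X \<omega> \<in> B}"
    using EB[OF \<open>B \<in> sets N\<close>] sets.sets_into_space[OF \<open>B \<in> sets N\<close>] by (simp add: measure_def E_def Int_absorb2)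
  ultimately show ?thesis
    by (simp add: set_lebesgue_integral_def cprob_def D_def E_def mult.commute)
qed

end

theory Submission
  imports Defs
begin

text \<open>
  Write \<open>p(y0, y1)\<close> for the conditional probabilities of the four outcome pairs given \<open>X\<close>; they
  sum to 1. Pointwise, an uplift bound misses \<open>p(y0, y1)\<close> by the minimum of two distinct cells,
  and \<open>min p q * ln 2 \<le> - p ln p - q ln q\<close> whenever \<open>p + q \<le> 1\<close>. Integrating, the gap between an
  uplift bound and the joint probability is at most a constant times \<open>H(Y0, Y1 | X)\<close>.

  The difference \<open>H(Y0, Y1) - H(Y0, Y1 | X)\<close> is the Jensen gap of \<open>t ln t\<close>, summed over the cells.
  As \<open>t ln t\<close> is strongly convex on \<open>[0, 1]\<close>, it controls the variances of the \<open>p(y0, y1)\<close>. The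
  Frechet bounds are Lipschitz in the marginals, so the uplift bounds differ from them by
  \<open>O(sqrt (H(Y0, Y1) - H(Y0, Y1 | X)))\<close>. All constants depend only on the base of the logarithm.
\<close>

section \<open>Elementary inequalities for \<open>t ln t\<close> and the Frechet functions\<close>

text \<open>The second derivative of \<open>t ln t\<close> is \<open>1 / t\<close>, which is at
  least \<open>1 / 2\<close> on (0, 2). So \<open>t ln t\<close> stays convex after subtracting
  \<open>t^2 / 4\<close>, and the tangent inequality of the difference at \<open>q\<close> is the
  claim once the squares are collected.\<close>

lemma x_ln_x_above_tangent:
  fixes p q :: real
  assumes "0 \<le> p" "p \<le> 1" "0 < q" "q \<le> 1"
  shows "q * ln q + (ln q + 1) * (p - q) + (p - q)\<^sup>2 / 4 \<le> p * ln p"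
proof (cases "p = 0")
  case True
  \<comment> \<open>At \<open>p = 0\<close> the right side is 0, because
    \<open>0 * ln 0 = 0\<close>, and the left side collapses to \<open>q^2 / 4 - q\<close>.\<close>
  have "q * q \<le> q * 1" using assms by (intro mult_left_mono) auto
  then show ?thesis using True assms by (simp add: algebra_simps power2_eq_square)
next
  case False
  \<comment> \<open>The interval reaches beyond 1 so that the tangent point \<open>q = 1\<close> is interior.\<close>
  have "convex_on {0<..<2} (\<lambda>x::real. x * ln x - x\<^sup>2 / 4)"
    by (rule f''_ge0_imp_convex[where f' = "\<lambda>x. ln x + 1 - x / 2" and f'' = "\<lambda>x. 1 / x - 1 / 2"])
      (auto intro!: derivative_eq_intros simp: field_simps)
  moreover have "((\<lambda>x::real. x * ln x - x\<^sup>2 / 4) has_real_derivative (ln q + 1 - q / 2)) (at q)"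
    using assms by (auto intro!: derivative_eq_intros)
  ultimately have "p * ln p - p\<^sup>2 / 4 - (q * ln q - q\<^sup>2 / 4) \<ge> (ln q + 1 - q / 2) * (p - q)"
    using assms False
    by (intro convex_on_imp_above_tangent[where A = "{0<..<2}" and c = q and x = p])
      (auto intro: has_field_derivative_at_within)
  then show ?thesis by (simp add: field_simps power2_eq_square)
qed

lemma x_ln_x_nonpos: "0 \<le> x \<Longrightarrow> x \<le> 1 \<Longrightarrow> x * ln x \<le> 0" for x :: real
  by (cases "x = 0") (auto simp: mult_nonneg_nonpos)

text \<open>The smaller number \<open>r\<close> is at most 1/2, so \<open>- ln r\<close> is at least
  \<open>ln 2\<close> when \<open>r\<close> is positive. Its own entropy term therefore already
  suffices, and the other term is nonnegative.\<close>

lemma min_le_binary_entropy: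
  fixes p q :: real
  assumes "0 \<le> p" "0 \<le> q" "p + q \<le> 1"
  shows "min p q * ln 2 \<le> - (p * ln p) - q * ln q"
proof -
  have half: "r * ln 2 \<le> - (r * ln r)" if "0 \<le> r" "r \<le> 1 / 2" for r :: real
  proof (cases "r = 0")
    case False
    then have "ln r \<le> ln (1 / 2)" using that by (subst ln_le_cancel_iff) auto
    then have "r * ln r \<le> r * ln (1 / 2)" using that by (intro mult_left_mono) auto
    then show ?thesis by (simp add: ln_div)
  qed simp
  show ?thesis
    using half[of p] half[of q] x_ln_x_nonpos[of p] x_ln_x_nonpos[of q] assms by (cases "p \<le> q") auto
qed

text \<open>Each Frechet function is a maximum or minimum of two affine functions whose coefficients
  lie in {-1, 0, 1}.\<close>

lemma frechet_lower_lipschitz: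
  "\<bar>frechet_lower y0 y1 s0 s1 - frechet_lower y0 y1 t0 t1\<bar> \<le> \<bar>s0 - t0\<bar> + \<bar>s1 - t1\<bar>"
  by (cases y0; cases y1; simp; linarith)

lemma frechet_upper_lipschitz:
  "\<bar>frechet_upper y0 y1 s0 s1 - frechet_upper y0 y1 t0 t1\<bar> \<le> \<bar>s0 - t0\<bar> + \<bar>s1 - t1\<bar>"
  by (cases y0; cases y1; simp; linarith)

lemma sum_bool_pair:
  "(\<Sum>z\<in>UNIV. g z) = g (False, False) + g (False, True) + g (True, False) + g (True, True)"
  for g :: "bool \<times> bool \<Rightarrow> 'c::comm_monoid_add"
  by (simp add: UNIV_Times_UNIV[symmetric] UNIV_bool del: UNIV_Times_UNIV) (simp add: ac_simps)

section \<open>Conditional probabilities given the features\<close>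

lemma cprob_nonneg [simp]: "0 \<le> cprob M N X Q x"
  by (simp add: cprob_def)

lemma borel_measurable_cprob [measurable]: "cprob M N X Q \<in> borel_measurable N"
proof -
  have "cprob M N X Q \<in> borel_measurable (distr M N X)"
    unfolding cprob_def by measurable
  then show ?thesis by simp
qed

context prob_space
begin

text \<open>On a set \<open>B\<close> where the version exceeds 1, its integral is P(Q, X in B),
  which is at most P(X in B). The excess over 1 is thus nonnegative with nonpositive integral, and
  so vanishes almost everywhere.\<close>

lemma AE_cprob_le_1:
  assumes [measurable]: "X \<in> M \<rightarrow>\<^sub>M N" "Q \<in> M \<rightarrow>\<^sub>M count_space UNIV"
  shows "AE x in distr M N X. cprob M N X Q x \<le> 1"
proof -
  interpret D: prob_space "distr M N X" by (rule prob_space_distr) measurable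
  \<comment> \<open>Integrability of \<open>cprob\<close> is itself deduced from this lemma. Cutting
    at level \<open>n\<close> keeps the integrands bounded; the countably many levels are united
    afterwards.\<close>
  have "AE x in distr M N X. \<not> (1 < cprob M N X Q x \<and> cprob M N X Q x \<le> real n)" for n
  proof -
    define B where "B = {x \<in> space N. 1 < cprob M N X Q x \<and> cprob M N X Q x \<le> real n}"
    have [measurable]: "B \<in> sets N" unfolding B_def by measurable
    have int: "integrable (distr M N X) (\<lambda>x. indicator B x * cprob M N X Q x)"
      by (rule D.integrable_const_bound[where B = "real n"])
        (auto simp: B_def split: split_indicator)
    have int': "integrable (distr M N X) (\<lambda>x. indicator B x * (cprob M N X Q x - 1))"
      by (rule D.integrable_const_bound[where B = "real n"])
        (auto simp: B_def split: split_indicator)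
    have "(\<integral>x. indicator B x * cprob M N X Q x \<partial>distr M N X) \<le> D.prob B"
      unfolding real_scaleR_def[symmetric] set_lebesgue_integral_def[symmetric]
      by (subst set_integral_cprob[symmetric])
        (auto simp: measure_distr vimage_def intro!: finite_measure_mono)
    then have "(\<integral>x. indicator B x * (cprob M N X Q x - 1) \<partial>distr M N X) \<le> 0"
      using int Bochner_Integration.integral_diff[OF int, of "indicator B"]
      by (simp add: right_diff_distrib D.emeasure_eq_measure)
    moreover have nonneg: "AE x in distr M N X. 0 \<le> indicator B x * (cprob M N X Q x - 1)"
      by (auto simp: B_def split: split_indicator)
    then have "0 \<le> (\<integral>x. indicator B x * (cprob M N X Q x - 1) \<partial>distr M N X)"
      by (rule integral_nonneg_AE)
    ultimately have "AE x in distr M N X. indicator B x * (cprob M N X Q x - 1) = 0"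
      using integral_nonneg_eq_0_iff_AE[OF int' nonneg] by linarith
    then show ?thesis
      using AE_space by eventually_elim (auto simp: B_def split: split_indicator_asm)
  qed
  then have "AE x in distr M N X. \<forall>n. \<not> (1 < cprob M N X Q x \<and> cprob M N X Q x \<le> real n)"
    unfolding AE_all_countable by blast
  then show ?thesis
    by eventually_elim (meson not_le real_arch_simple)
qed

lemma integrable_cprob:
  assumes [measurable]: "X \<in> M \<rightarrow>\<^sub>M N" "Q \<in> M \<rightarrow>\<^sub>M count_space UNIV"
  shows "integrable (distr M N X) (cprob M N X Q)"
proof -
  interpret D: prob_space "distr M N X" by (rule prob_space_distr) measurable
  show ?thesis
    using AE_cprob_le_1[OF assms] by (intro D.integrable_const_bound[where B = 1]) auto
qed

text \<open>Integrable functions with equal integrals over every measurable set agree almost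
  everywhere. By \<open>set_integral_cprob\<close>, the set integrals turn the claim into additivity
  of \<open>prob\<close> on disjoint events.\<close>

lemma AE_cprob_disjoint_add:
  assumes [measurable]: "X \<in> M \<rightarrow>\<^sub>M N" "Q \<in> M \<rightarrow>\<^sub>M count_space UNIV" "R \<in> M \<rightarrow>\<^sub>M count_space UNIV"
    and disjoint: "\<And>\<omega>. \<not> (Q \<omega> \<and> R \<omega>)"
  shows "AE x in distr M N X. cprob M N X (\<lambda>\<omega>. Q \<omega> \<or> R \<omega>) x = cprob M N X Q x + cprob M N X R x"
proof (rule density_unique_real)
  show "integrable (distr M N X) (cprob M N X (\<lambda>\<omega>. Q \<omega> \<or> R \<omega>))"
    by (rule integrable_cprob) measurable
  show "integrable (distr M N X) (\<lambda>x. cprob M N X Q x + cprob M N X R x)"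
    by (intro Bochner_Integration.integrable_add integrable_cprob) measurable
  fix A assume "A \<in> sets (distr M N X)"
  then have [measurable]: "A \<in> sets N" by simp
  have "(\<integral>x\<in>A. cprob M N X (\<lambda>\<omega>. Q \<omega> \<or> R \<omega>) x \<partial>distr M N X)
      = prob {\<omega> \<in> space M. (Q \<omega> \<or> R \<omega>) \<and> X \<omega> \<in> A}"
    by (rule set_integral_cprob[symmetric]) measurable
  also have "\<dots> = prob ({\<omega> \<in> space M. Q \<omega> \<and> X \<omega> \<in> A} \<union> {\<omega> \<in> space M. R \<omega> \<and> X \<omega> \<in> A})"
    by (rule arg_cong[where f = prob]) auto
  also have "\<dots> = prob {\<omega> \<in> space M. Q \<omega> \<and> X \<omega> \<in> A} + prob {\<omega> \<in> space M. R \<omega> \<and> X \<omega> \<in> A}"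
    by (rule finite_measure_Union) (use disjoint in auto)
  also have "\<dots> = (\<integral>x\<in>A. cprob M N X Q x \<partial>distr M N X) + (\<integral>x\<in>A. cprob M N X R x \<partial>distr M N X)"
    by (subst (1 2) set_integral_cprob[where N = N]) auto
  also have "\<dots> = (\<integral>x\<in>A. cprob M N X Q x + cprob M N X R x \<partial>distr M N X)"
    by (rule set_integral_add(2)[symmetric])
      (auto simp: set_integrable_def intro!: integrable_mult_indicator integrable_cprob
        simp del: real_scaleR_def)
  finally show "(\<integral>x\<in>A. cprob M N X (\<lambda>\<omega>. Q \<omega> \<or> R \<omega>) x \<partial>distr M N X)
      = (\<integral>x\<in>A. cprob M N X Q x + cprob M N X R x \<partial>distr M N X)" .
qed

lemma AE_cprob_True:
  assumes [measurable]: "X \<in> M \<rightarrow>\<^sub>M N"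
  shows "AE x in distr M N X. cprob M N X (\<lambda>\<omega>. True) x = 1"
proof (rule density_unique_real)
  interpret D: prob_space "distr M N X" by (rule prob_space_distr) measurable
  show "integrable (distr M N X) (\<lambda>x. 1 :: real)" by simp
  show "integrable (distr M N X) (cprob M N X (\<lambda>\<omega>. True))"
    by (rule integrable_cprob) measurable
  fix A assume "A \<in> sets (distr M N X)"
  then have [measurable]: "A \<in> sets N" by simp
  have "(\<integral>x\<in>A. cprob M N X (\<lambda>\<omega>. True) x \<partial>distr M N X) = prob {\<omega> \<in> space M. True \<and> X \<omega> \<in> A}"
    by (rule set_integral_cprob[symmetric]) measurable
  also have "\<dots> = D.prob A"
    by (auto simp: measure_distr intro!: arg_cong[where f = prob])
  also have "\<dots> = (\<integral>x\<in>A. 1 \<partial>distr M N X)"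
    using sets.sets_into_space[OF \<open>A \<in> sets N\<close>] by (simp add: set_lebesgue_integral_def Int_absorb2)
  finally show "(\<integral>x\<in>A. cprob M N X (\<lambda>\<omega>. True) x \<partial>distr M N X) = (\<integral>x\<in>A. 1 \<partial>distr M N X)" .
qed

lemma expectation_cprob:
  assumes [measurable]: "X \<in> M \<rightarrow>\<^sub>M N" "Q \<in> M \<rightarrow>\<^sub>M count_space UNIV"
  shows "expectation (\<lambda>\<omega>. cprob M N X Q (X \<omega>)) = prob {\<omega> \<in> space M. Q \<omega>}"
proof -
  have "prob {\<omega> \<in> space M. Q \<omega>} = prob {\<omega> \<in> space M. Q \<omega> \<and> X \<omega> \<in> space N}"
    using measurable_space[OF assms(1)] by (intro arg_cong[where f = prob]) auto
  also have "\<dots> = (\<integral>x\<in>space N. cprob M N X Q x \<partial>distr M N X)"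
    by (rule set_integral_cprob) measurable
  also have "\<dots> = (\<integral>x. cprob M N X Q x \<partial>distr M N X)"
    using set_integral_space[OF integrable_cprob[OF assms]] by simp
  also have "\<dots> = expectation (\<lambda>\<omega>. cprob M N X Q (X \<omega>))"
    by (rule integral_distr) measurable
  finally show ?thesis ..
qed

text \<open>This is nonnegativity of the variance of the absolute value of \<open>Z\<close>.\<close>

lemma expectation_abs_le_sqrt:
  fixes Z :: "'a \<Rightarrow> real"
  assumes "integrable M Z" "integrable M (\<lambda>\<omega>. (Z \<omega>)\<^sup>2)"
  shows "expectation (\<lambda>\<omega>. \<bar>Z \<omega>\<bar>) \<le> sqrt (expectation (\<lambda>\<omega>. (Z \<omega>)\<^sup>2))"
  using variance_eq[of "\<lambda>\<omega>. \<bar>Z \<omega>\<bar>"] variance_positive[of "\<lambda>\<omega>. \<bar>Z \<omega>\<bar>"] assms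
  by (intro real_le_rsqrt) auto

end

section \<open>The conditional cells and their linear relations\<close>

text \<open>Composition with \<open>X\<close> makes the cells random variables on \<open>M\<close>,
  so that all later integrals are expectations under one probability measure.\<close>

definition (in uplift_model) cell :: "bool \<Rightarrow> bool \<Rightarrow> 'a \<Rightarrow> real" where
  "cell y0 y1 \<omega> = cprob M N X (\<lambda>\<omega>. Y0 \<omega> = y0 \<and> Y1 \<omega> = y1) (X \<omega>)"

context uplift_model
begin

lemma X_measurable [measurable]: "X \<in> M \<rightarrow>\<^sub>M N"
  using X_distributed by (rule distributed_measurable)

lemmas outcomes_measurable [measurable] = Y0_measurable Y1_measurable

lemma cell_measurable [measurable]: "cell y0 y1 \<in> borel_measurable M"
  unfolding cell_def by measurable

lemma cell_nonneg [simp]: "0 \<le> cell y0 y1 \<omega>"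
  by (simp add: cell_def)

lemma AE_feature: "AE x in distr M N X. P x \<Longrightarrow> AE \<omega> in M. P (X \<omega>)"
  by (rule AE_distrD[OF X_measurable])

lemma AE_marginal0: "AE \<omega> in M. cprob M N X Y0 (X \<omega>) = cell True False \<omega> + cell True True \<omega>"
proof -
  \<comment> \<open>The explicit comparisons with \<open>True\<close> and \<open>False\<close> make
    the disjuncts literally the events in \<open>cell\<close>.\<close>
  have "AE x in distr M N X. cprob M N X (\<lambda>\<omega>. (Y0 \<omega> = True \<and> Y1 \<omega> = False) \<or> (Y0 \<omega> = True \<and> Y1 \<omega> = True)) x =
     cprob M N X (\<lambda>\<omega>. Y0 \<omega> = True \<and> Y1 \<omega> = False) x + cprob M N X (\<lambda>\<omega>. Y0 \<omega> = True \<and> Y1 \<omega> = True) x"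
    by (rule AE_cprob_disjoint_add) auto
  moreover have "(\<lambda>\<omega>. (Y0 \<omega> = True \<and> Y1 \<omega> = False) \<or> (Y0 \<omega> = True \<and> Y1 \<omega> = True)) = Y0"
    by auto
  ultimately show ?thesis
    unfolding cell_def by (intro AE_feature) simp
qed


lemma AE_marginal1: "AE \<omega> in M. cprob M N X Y1 (X \<omega>) = cell False True \<omega> + cell True True \<omega>"
proof -
  have "AE x in distr M N X. cprob M N X (\<lambda>\<omega>. (Y0 \<omega> = False \<and> Y1 \<omega> = True) \<or> (Y0 \<omega> = True \<and> Y1 \<omega> = True)) x =
     cprob M N X (\<lambda>\<omega>. Y0 \<omega> = False \<and> Y1 \<omega> = True) x + cprob M N X (\<lambda>\<omega>. Y0 \<omega> = True \<and> Y1 \<omega> = True) x"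
    by (rule AE_cprob_disjoint_add) auto
  moreover have "(\<lambda>\<omega>. (Y0 \<omega> = False \<and> Y1 \<omega> = True) \<or> (Y0 \<omega> = True \<and> Y1 \<omega> = True)) = Y1"
    by auto
  ultimately show ?thesis
    unfolding cell_def by (intro AE_feature) simp
qed

text \<open>The certain event is split by \<open>Y0\<close>, and each half is split by
  \<open>Y1\<close>; the half where \<open>Y0\<close> holds is \<open>AE_marginal0\<close>.\<close>

lemma AE_cell_sum:
  "AE \<omega> in M. cell False False \<omega> + cell False True \<omega> + cell True False \<omega> + cell True True \<omega> = 1"
proof -
  have "AE x in distr M N X.
      cprob M N X (\<lambda>\<omega>. (Y0 \<omega> = False \<and> Y1 \<omega> = False) \<or> (Y0 \<omega> = False \<and> Y1 \<omega> = True)) x =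
      cprob M N X (\<lambda>\<omega>. Y0 \<omega> = False \<and> Y1 \<omega> = False) x + cprob M N X (\<lambda>\<omega>. Y0 \<omega> = False \<and> Y1 \<omega> = True) x"
    by (rule AE_cprob_disjoint_add) auto
  moreover have "(\<lambda>\<omega>. (Y0 \<omega> = False \<and> Y1 \<omega> = False) \<or> (Y0 \<omega> = False \<and> Y1 \<omega> = True)) = (\<lambda>\<omega>. \<not> Y0 \<omega>)"
    by auto
  ultimately have "AE \<omega> in M. cprob M N X (\<lambda>\<omega>. \<not> Y0 \<omega>) (X \<omega>) = cell False False \<omega> + cell False True \<omega>"
    unfolding cell_def by (intro AE_feature) simp
  moreover have "AE x in distr M N X. cprob M N X (\<lambda>\<omega>. \<not> Y0 \<omega> \<or> Y0 \<omega>) x =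
      cprob M N X (\<lambda>\<omega>. \<not> Y0 \<omega>) x + cprob M N X Y0 x"
    by (rule AE_cprob_disjoint_add) auto
  then have "AE \<omega> in M. cprob M N X (\<lambda>\<omega>. True) (X \<omega>) =
      cprob M N X (\<lambda>\<omega>. \<not> Y0 \<omega>) (X \<omega>) + cprob M N X Y0 (X \<omega>)"
    by (intro AE_feature) simp
  moreover have "AE \<omega> in M. cprob M N X (\<lambda>\<omega>. True) (X \<omega>) = 1"
    by (intro AE_feature AE_cprob_True) measurable
  ultimately show ?thesis
    using AE_marginal0 by eventually_elim simp
qed

lemma AE_cell_le_1: "AE \<omega> in M. cell y0 y1 \<omega> \<le> 1"
  unfolding cell_def by (intro AE_feature AE_cprob_le_1) measurable

lemma cell_integrable [simp]: "integrable M (cell y0 y1)"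
  by (rule integrable_const_bound[where B = 1]) (use AE_cell_le_1 in auto)

lemma expectation_cell: "expectation (cell y0 y1) = joint_prob M Y0 Y1 y0 y1"
  unfolding cell_def[abs_def] joint_prob_def by (rule expectation_cprob) measurable

lemma cell_ln_integrable [simp]: "integrable M (\<lambda>\<omega>. cell y0 y1 \<omega> * ln (cell y0 y1 \<omega>))"
proof (rule integrable_const_bound[where B = 1])
  have "\<bar>p * ln p\<bar> \<le> 1" if "0 \<le> p" "p \<le> 1" for p :: real
  proof -
    \<comment> \<open>The tangent at \<open>q = 1\<close>, where the logarithm vanishes, bounds
      \<open>p ln p\<close> below by \<open>p - 1\<close>, hence by -1.\<close>
    have "p - 1 + (p - 1)\<^sup>2 / 4 \<le> p * ln p"
      using x_ln_x_above_tangent[of p 1] that by simp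
    then show ?thesis
      using x_ln_x_nonpos[OF that] zero_le_power2[of "p - 1"] that(1) by linarith
  qed
  then show "AE \<omega> in M. norm (cell y0 y1 \<omega> * ln (cell y0 y1 \<omega>)) \<le> 1"
    using AE_cell_le_1[of y0 y1] by auto
qed measurable

section \<open>Both entropies as sums over the four cells\<close>

text \<open>As \<open>f\<close> is the density of \<open>X\<close>, the integral over
  \<open>N\<close> weighted by \<open>f\<close> is an expectation over \<open>M\<close>. The factor
  \<open>ln b\<close> converts to natural logarithms, in which the scalar inequalities are
  stated.\<close>

lemma cond_entropy_eq:
  assumes "b > 1"
  shows "outcome_cond_entropy b M N X f Y0 Y1 * ln b =
    - (\<Sum>(y0, y1)\<in>UNIV. expectation (\<lambda>\<omega>. cell y0 y1 \<omega> * ln (cell y0 y1 \<omega>)))"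
proof -
  let ?p = "\<lambda>y0 y1. cprob M N X (\<lambda>\<omega>. Y0 \<omega> = y0 \<and> Y1 \<omega> = y1)"
  have "outcome_cond_entropy b M N X f Y0 Y1 =
      - (\<integral>x. f x * (\<Sum>(y0, y1)\<in>UNIV. ?p y0 y1 x * log b (?p y0 y1 x)) \<partial>N)"
    unfolding outcome_cond_entropy_def by (simp add: mult.commute)
  also have "(\<integral>x. f x * (\<Sum>(y0, y1)\<in>UNIV. ?p y0 y1 x * log b (?p y0 y1 x)) \<partial>N) =
      expectation (\<lambda>\<omega>. \<Sum>(y0, y1)\<in>UNIV. ?p y0 y1 (X \<omega>) * log b (?p y0 y1 (X \<omega>)))"
    by (rule distributed_integral[OF X_distributed]) (simp_all add: sum_bool_pair f_nonneg)
  also have "\<dots> = expectation (\<lambda>\<omega>. (\<Sum>(y0, y1)\<in>UNIV. cell y0 y1 \<omega> * ln (cell y0 y1 \<omega>)) / ln b)"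
    by (simp add: cell_def[symmetric] sum_bool_pair log_def add_divide_distrib)
  also have "\<dots> = (\<Sum>(y0, y1)\<in>UNIV. expectation (\<lambda>\<omega>. cell y0 y1 \<omega> * ln (cell y0 y1 \<omega>))) / ln b"
    by (simp add: sum_bool_pair)
  finally show ?thesis using assms by simp
qed

lemma entropy_eq:
  assumes "b > 1"
  shows "outcome_entropy b M Y0 Y1 * ln b =
    - (\<Sum>(y0, y1)\<in>UNIV. joint_prob M Y0 Y1 y0 y1 * ln (joint_prob M Y0 Y1 y0 y1))"
proof -
  interpret information_space M b by unfold_locales fact
  let ?Z = "\<lambda>\<omega>. (Y0 \<omega>, Y1 \<omega>)"
  let ?q = "\<lambda>(y0, y1). joint_prob M Y0 Y1 y0 y1"
  have *: "simple_function M ?Z"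
    unfolding simple_function_def
  proof safe
    show "?Z -` {(y0, y1)} \<inter> space M \<in> events" for y0 y1
    proof -
      have "{\<omega> \<in> space M. Y0 \<omega> = y0 \<and> Y1 \<omega> = y1} \<in> events" by measurable
      moreover have "?Z -` {(y0, y1)} \<inter> space M = {\<omega> \<in> space M. Y0 \<omega> = y0 \<and> Y1 \<omega> = y1}" by auto
      ultimately show ?thesis by simp
    qed
  qed simp
  have "distributed M (count_space UNIV) ?Z (\<lambda>z. ennreal (if z \<in> ?Z ` space M then ?q z else 0))"
    by (rule distributed_simple_function_superset[OF *])
      (auto simp: joint_prob_def intro!: arg_cong[where f = prob])
  \<comment> \<open>The density supplied for a simple function is cut off outside its range. A pair
    that is never attained has joint probability 0 anyway, so the cutoff changes nothing.\<close>
  moreover have "(if z \<in> ?Z ` space M then ?q z else 0) = ?q z" for z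
  proof -
    have "?q z = 0" if "z \<notin> ?Z ` space M"
    proof -
      have "{\<omega> \<in> space M. Y0 \<omega> = fst z \<and> Y1 \<omega> = snd z} = {}" using that by (cases z) auto
      then show ?thesis unfolding joint_prob_def case_prod_beta by (metis measure_empty)
    qed
    then show ?thesis by simp
  qed
  ultimately have "distributed M (count_space UNIV) ?Z (\<lambda>z. ennreal (?q z))"
    by simp
  then have "outcome_entropy b M Y0 Y1 = - (\<integral>z. ?q z * log b (?q z) \<partial>count_space UNIV)"
    unfolding outcome_entropy_def by (rule entropy_distr) (auto simp: joint_prob_def)
  also have "\<dots> = - (\<Sum>z\<in>UNIV. ?q z * log b (?q z))"
    by (simp add: lebesgue_integral_count_space_finite)
  finally show ?thesis
    using assms by (simp add: sum_bool_pair log_def field_simps)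
qed

section \<open>Distance from the uplift bounds to the joint probability\<close>

text \<open>For the pair (1, 1), the marginals and the total mass give S0 + S1 - 1 = p11 - p00, and
  max 0 (p11 - p00) = p11 - min p11 p00. The other pairs follow by symmetry.\<close>

lemma AE_frechet_lower:
  "AE \<omega> in M. frechet_lower y0 y1 (cprob M N X Y0 (X \<omega>)) (cprob M N X Y1 (X \<omega>)) =
    cell y0 y1 \<omega> - min (cell y0 y1 \<omega>) (cell (\<not> y0) (\<not> y1) \<omega>)"
  using AE_marginal0 AE_marginal1 AE_cell_sum
  by eventually_elim (cases y0; cases y1; simp; linarith)

text \<open>For the pair (1, 1), both marginals contain p11, so min S0 S1 = p11 + min p10 p01. In
  general the two neighbours differing in one coordinate appear.\<close>

lemma AE_frechet_upper:
  "AE \<omega> in M. frechet_upper y0 y1 (cprob M N X Y0 (X \<omega>)) (cprob M N X Y1 (X \<omega>)) =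
    cell y0 y1 \<omega> + min (cell (\<not> y0) y1 \<omega>) (cell y0 (\<not> y1) \<omega>)"
  using AE_marginal0 AE_marginal1 AE_cell_sum
  by eventually_elim (cases y0; cases y1; simp; linarith)

lemma frechet_lower_measurable [measurable]:
  "(\<lambda>\<omega>. frechet_lower y0 y1 (cprob M N X Y0 (X \<omega>)) (cprob M N X Y1 (X \<omega>))) \<in> borel_measurable M"
  by (cases y0; cases y1) simp_all

lemma frechet_upper_measurable [measurable]:
  "(\<lambda>\<omega>. frechet_upper y0 y1 (cprob M N X Y0 (X \<omega>)) (cprob M N X Y1 (X \<omega>))) \<in> borel_measurable M"
  by (cases y0; cases y1) simp_all

text \<open>This is \<open>min_le_binary_entropy\<close> integrated. In the constant,
  \<open>1 / ln 2\<close> comes from that inequality and \<open>ln b\<close> from the base of the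
  entropy.\<close>

lemma expectation_min_cell_le:
  assumes "b > 1" "(y0, y1) \<noteq> (z0, z1)"
  shows "expectation (\<lambda>\<omega>. min (cell y0 y1 \<omega>) (cell z0 z1 \<omega>))
    \<le> outcome_cond_entropy b M N X f Y0 Y1 * (ln b / ln 2)"
proof -
  have "expectation (\<lambda>\<omega>. min (cell y0 y1 \<omega>) (cell z0 z1 \<omega>) * ln 2)
      \<le> expectation (\<lambda>\<omega>. - (\<Sum>(y0, y1)\<in>UNIV. cell y0 y1 \<omega> * ln (cell y0 y1 \<omega>)))"
  proof (rule integral_mono_AE)
    show "AE \<omega> in M. min (cell y0 y1 \<omega>) (cell z0 z1 \<omega>) * ln 2
        \<le> - (\<Sum>(y0, y1)\<in>UNIV. cell y0 y1 \<omega> * ln (cell y0 y1 \<omega>))"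
      using AE_cell_sum
    proof eventually_elim
      case (elim \<omega>)
      have nonneg: "0 \<le> cell v0 v1 \<omega>" for v0 v1 by simp
      have sum: "(\<Sum>(v0, v1)\<in>UNIV. cell v0 v1 \<omega>) = 1" using elim by (simp add: sum_bool_pair)
      have "cell v0 v1 \<omega> \<le> 1" for v0 v1
        using member_le_sum[of "(v0, v1)" UNIV "\<lambda>(v0, v1). cell v0 v1 \<omega>"] sum by (simp add: case_prod_beta)
      then have ent: "0 \<le> - (cell v0 v1 \<omega> * ln (cell v0 v1 \<omega>))" for v0 v1
        by (simp add: x_ln_x_nonpos)
      \<comment> \<open>Distinctness of the two cells enters here. The fact serves twice: with the
        cells it yields total mass at most 1, with the entropy terms it adds the two remaining
        cells.\<close>
      have pair: "g y0 y1 + g z0 z1 \<le> (\<Sum>(v0, v1)\<in>UNIV. g v0 v1)"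
        if "\<And>v0 v1. 0 \<le> g v0 v1" for g :: "bool \<Rightarrow> bool \<Rightarrow> real"
        using sum_mono2[of UNIV "{(y0, y1), (z0, z1)}" "\<lambda>(v0, v1). g v0 v1"] assms(2) that
        by (simp add: case_prod_beta)
      have "cell y0 y1 \<omega> + cell z0 z1 \<omega> \<le> 1"
        using pair[of "\<lambda>v0 v1. cell v0 v1 \<omega>"] sum by simp
      then have "min (cell y0 y1 \<omega>) (cell z0 z1 \<omega>) * ln 2
          \<le> - (cell y0 y1 \<omega> * ln (cell y0 y1 \<omega>)) - cell z0 z1 \<omega> * ln (cell z0 z1 \<omega>)"
        by (intro min_le_binary_entropy) auto
      also have "\<dots> \<le> (\<Sum>(v0, v1)\<in>UNIV. - (cell v0 v1 \<omega> * ln (cell v0 v1 \<omega>)))"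
        using pair[OF ent] by simp
      finally show ?case by (simp add: sum_bool_pair)
    qed
  qed (auto simp: sum_bool_pair)
  also have "\<dots> = outcome_cond_entropy b M N X f Y0 Y1 * ln b"
    unfolding cond_entropy_eq[OF assms(1)] by (simp add: sum_bool_pair)
  finally show ?thesis by (simp add: field_simps)
qed

lemma uplift_lower_gap:
  assumes "b > 1"
  shows "\<bar>uplift_lower_bound M N X Y0 Y1 y0 y1 - joint_prob M Y0 Y1 y0 y1\<bar>
    \<le> outcome_cond_entropy b M N X f Y0 Y1 * (ln b / ln 2)"
proof -
  have "uplift_lower_bound M N X Y0 Y1 y0 y1 =
      expectation (\<lambda>\<omega>. cell y0 y1 \<omega> - min (cell y0 y1 \<omega>) (cell (\<not> y0) (\<not> y1) \<omega>))"
    unfolding uplift_lower_bound_def by (rule integral_cong_AE[OF _ _ AE_frechet_lower]) measurable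
  then have "uplift_lower_bound M N X Y0 Y1 y0 y1 - joint_prob M Y0 Y1 y0 y1 =
      - expectation (\<lambda>\<omega>. min (cell y0 y1 \<omega>) (cell (\<not> y0) (\<not> y1) \<omega>))"
    by (simp add: expectation_cell[symmetric])
  moreover have "0 \<le> expectation (\<lambda>\<omega>. min (cell y0 y1 \<omega>) (cell (\<not> y0) (\<not> y1) \<omega>))"
    by (rule integral_nonneg_AE) simp
  ultimately show ?thesis
    using expectation_min_cell_le[OF assms, of y0 y1 "\<not> y0" "\<not> y1"] by simp
qed

lemma uplift_upper_gap:
  assumes "b > 1"
  shows "\<bar>uplift_upper_bound M N X Y0 Y1 y0 y1 - joint_prob M Y0 Y1 y0 y1\<bar>
    \<le> outcome_cond_entropy b M N X f Y0 Y1 * (ln b / ln 2)"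
proof -
  have "uplift_upper_bound M N X Y0 Y1 y0 y1 =
      expectation (\<lambda>\<omega>. cell y0 y1 \<omega> + min (cell (\<not> y0) y1 \<omega>) (cell y0 (\<not> y1) \<omega>))"
    unfolding uplift_upper_bound_def by (rule integral_cong_AE[OF _ _ AE_frechet_upper]) measurable
  then have "uplift_upper_bound M N X Y0 Y1 y0 y1 - joint_prob M Y0 Y1 y0 y1 =
      expectation (\<lambda>\<omega>. min (cell (\<not> y0) y1 \<omega>) (cell y0 (\<not> y1) \<omega>))"
    by (simp add: expectation_cell[symmetric])
  moreover have "0 \<le> expectation (\<lambda>\<omega>. min (cell (\<not> y0) y1 \<omega>) (cell y0 (\<not> y1) \<omega>))"
    by (rule integral_nonneg_AE) simp
  ultimately show ?thesis
    using expectation_min_cell_le[OF assms, of "\<not> y0" y1 y0 "\<not> y1"] by simp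
qed

section \<open>Distance from the uplift bounds to the Frechet bounds\<close>

lemma cell_deviation_integrable [simp]:
  "integrable M (\<lambda>\<omega>. (cell y0 y1 \<omega> - joint_prob M Y0 Y1 y0 y1)\<^sup>2)"
proof (rule integrable_const_bound[where B = 1])
  have q: "0 \<le> joint_prob M Y0 Y1 y0 y1" "joint_prob M Y0 Y1 y0 y1 \<le> 1"
    by (auto simp: joint_prob_def)
  show "AE \<omega> in M. norm ((cell y0 y1 \<omega> - joint_prob M Y0 Y1 y0 y1)\<^sup>2) \<le> 1"
    using AE_cell_le_1[of y0 y1]
  proof eventually_elim
    case (elim \<omega>)
    have "\<bar>cell y0 y1 \<omega> - joint_prob M Y0 Y1 y0 y1\<bar> \<le> 1"
      using elim q cell_nonneg[of y0 y1 \<omega>] by linarith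
    then show ?case by (simp add: abs_square_le_1)
  qed
qed measurable

text \<open>The inequality \<open>x_ln_x_above_tangent\<close> is integrated at the mean
  \<open>q\<close> of the cell: the linear term has expectation 0 and the quadratic term leaves a
  quarter of the variance.\<close>

lemma cell_jensen_gap:
  "expectation (\<lambda>\<omega>. (cell y0 y1 \<omega> - joint_prob M Y0 Y1 y0 y1)\<^sup>2) / 4 \<le>
    expectation (\<lambda>\<omega>. cell y0 y1 \<omega> * ln (cell y0 y1 \<omega>))
      - joint_prob M Y0 Y1 y0 y1 * ln (joint_prob M Y0 Y1 y0 y1)"
proof -
  define q where "q = joint_prob M Y0 Y1 y0 y1"
  have q: "0 \<le> q" "q \<le> 1" by (auto simp: q_def joint_prob_def)
  have E: "expectation (cell y0 y1) = q" by (simp add: expectation_cell q_def)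
  have [simp]: "integrable M (\<lambda>\<omega>. (cell y0 y1 \<omega> - q)\<^sup>2)"
    unfolding q_def by (rule cell_deviation_integrable)
  have "expectation (\<lambda>\<omega>. (cell y0 y1 \<omega> - q)\<^sup>2) / 4 \<le>
    expectation (\<lambda>\<omega>. cell y0 y1 \<omega> * ln (cell y0 y1 \<omega>)) - q * ln q"
  proof (cases "q = 0")
    \<comment> \<open>There is no tangent to \<open>t ln t\<close> at 0, but then the cell vanishes almost surely.\<close>
    case True
    then have zero: "AE \<omega> in M. cell y0 y1 \<omega> = 0"
      using integral_nonneg_eq_0_iff_AE[of M "cell y0 y1"] E by simp
    then have "expectation (\<lambda>\<omega>. (cell y0 y1 \<omega> - q)\<^sup>2) = expectation (\<lambda>\<omega>. 0)"
      by (intro integral_cong_AE) (auto simp: True)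
    moreover have "expectation (\<lambda>\<omega>. cell y0 y1 \<omega> * ln (cell y0 y1 \<omega>)) = expectation (\<lambda>\<omega>. 0)"
      using zero by (intro integral_cong_AE) auto
    ultimately show ?thesis using True by simp
  next
    case False
    have "expectation (\<lambda>\<omega>. q * ln q + (ln q + 1) * (cell y0 y1 \<omega> - q) + (cell y0 y1 \<omega> - q)\<^sup>2 / 4)
        \<le> expectation (\<lambda>\<omega>. cell y0 y1 \<omega> * ln (cell y0 y1 \<omega>))"
      using AE_cell_le_1[of y0 y1] q False
      by (intro integral_mono_AE) (auto intro!: x_ln_x_above_tangent)
    then show ?thesis by (simp add: E prob_space)
  qed
  then show ?thesis by (simp add: q_def)
qed

text \<open>The Jensen gaps of all cells add up to the entropy difference, the mutual information of
  \<open>X\<close> and the outcome pair, in natural units. Since every variance is nonnegative, one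
  cell is bounded by the whole sum.\<close>

lemma cell_variance_le:
  assumes "b > 1"
  shows "expectation (\<lambda>\<omega>. (cell y0 y1 \<omega> - joint_prob M Y0 Y1 y0 y1)\<^sup>2)
    \<le> 4 * ((outcome_entropy b M Y0 Y1 - outcome_cond_entropy b M N X f Y0 Y1) * ln b)"
proof -
  define D where "D = (\<lambda>(y0, y1). expectation (\<lambda>\<omega>. (cell y0 y1 \<omega> - joint_prob M Y0 Y1 y0 y1)\<^sup>2) / 4)"
  have "D (y0, y1) \<le> (\<Sum>z\<in>UNIV. D z)"
    by (rule member_le_sum) (auto simp: D_def)
  also have "\<dots> \<le> (\<Sum>(y0, y1)\<in>UNIV. expectation (\<lambda>\<omega>. cell y0 y1 \<omega> * ln (cell y0 y1 \<omega>))
      - joint_prob M Y0 Y1 y0 y1 * ln (joint_prob M Y0 Y1 y0 y1))"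
    by (rule sum_mono) (auto simp: D_def intro: cell_jensen_gap)
  also have "\<dots> = (outcome_entropy b M Y0 Y1 - outcome_cond_entropy b M N X f Y0 Y1) * ln b"
    unfolding left_diff_distrib cond_entropy_eq[OF assms] entropy_eq[OF assms]
    by (simp add: sum_bool_pair)
  finally show ?thesis by (simp add: D_def)
qed

text \<open>An uplift bound is the mean of \<phi> at the conditional marginals, a Frechet bound is
  \<phi> at their means. A general Lipschitz \<phi> covers lower and upper bounds for all four
  outcome pairs at once.\<close>

lemma expectation_lipschitz_gap:
  fixes \<phi> :: "real \<Rightarrow> real \<Rightarrow> real"
  assumes "b > 1"
    and [measurable]: "(\<lambda>\<omega>. \<phi> (cprob M N X Y0 (X \<omega>)) (cprob M N X Y1 (X \<omega>))) \<in> borel_measurable M"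
    and lipschitz: "\<And>s0 s1 t0 t1. \<bar>\<phi> s0 s1 - \<phi> t0 t1\<bar> \<le> \<bar>s0 - t0\<bar> + \<bar>s1 - t1\<bar>"
  shows "\<bar>expectation (\<lambda>\<omega>. \<phi> (cprob M N X Y0 (X \<omega>)) (cprob M N X Y1 (X \<omega>)))
      - \<phi> (prob {\<omega> \<in> space M. Y0 \<omega>}) (prob {\<omega> \<in> space M. Y1 \<omega>})\<bar>
    \<le> 4 * sqrt (4 * ((outcome_entropy b M Y0 Y1 - outcome_cond_entropy b M N X f Y0 Y1) * ln b))"
proof -
  define S where "S \<omega> = \<phi> (cprob M N X Y0 (X \<omega>)) (cprob M N X Y1 (X \<omega>))" for \<omega>
  define s where "s = \<phi> (prob {\<omega> \<in> space M. Y0 \<omega>}) (prob {\<omega> \<in> space M. Y1 \<omega>})"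
  define d where "d y0 y1 \<omega> = \<bar>cell y0 y1 \<omega> - joint_prob M Y0 Y1 y0 y1\<bar>" for y0 y1 \<omega>
  define r where "r = sqrt (4 * ((outcome_entropy b M Y0 Y1 - outcome_cond_entropy b M N X f Y0 Y1) * ln b))"
  have [measurable]: "S \<in> borel_measurable M" unfolding S_def by measurable
  have [simp]: "integrable M (d y0 y1)" for y0 y1 unfolding d_def by simp
  have d_le: "expectation (d y0 y1) \<le> r" for y0 y1
    unfolding d_def r_def
    by (rule order_trans[OF expectation_abs_le_sqrt]) (auto intro: cell_variance_le[OF \<open>b > 1\<close>])
  have "prob {\<omega> \<in> space M. Y0 \<omega>} = expectation (\<lambda>\<omega>. cprob M N X Y0 (X \<omega>))"
    by (rule expectation_cprob[symmetric]) measurable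
  also have "\<dots> = expectation (\<lambda>\<omega>. cell True False \<omega> + cell True True \<omega>)"
    by (rule integral_cong_AE[OF _ _ AE_marginal0]) measurable
  finally have m0: "prob {\<omega> \<in> space M. Y0 \<omega>} =
      joint_prob M Y0 Y1 True False + joint_prob M Y0 Y1 True True"
    by (simp add: expectation_cell)
  have "prob {\<omega> \<in> space M. Y1 \<omega>} = expectation (\<lambda>\<omega>. cprob M N X Y1 (X \<omega>))"
    by (rule expectation_cprob[symmetric]) measurable
  also have "\<dots> = expectation (\<lambda>\<omega>. cell False True \<omega> + cell True True \<omega>)"
    by (rule integral_cong_AE[OF _ _ AE_marginal1]) measurable
  finally have m1: "prob {\<omega> \<in> space M. Y1 \<omega>} =
      joint_prob M Y0 Y1 False True + joint_prob M Y0 Y1 True True"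
    by (simp add: expectation_cell)
  \<comment> \<open>The cell (1, 1) enters both marginals, hence its coefficient 2; the coefficients
    sum to the constant 4 of the lemma.\<close>
  have bound: "AE \<omega> in M. \<bar>S \<omega> - s\<bar> \<le> d True False \<omega> + d False True \<omega> + 2 * d True True \<omega>"
    using AE_marginal0 AE_marginal1
  proof eventually_elim
    case (elim \<omega>)
    show ?case
      using lipschitz[of "cprob M N X Y0 (X \<omega>)" "cprob M N X Y1 (X \<omega>)"
          "prob {\<omega> \<in> space M. Y0 \<omega>}" "prob {\<omega> \<in> space M. Y1 \<omega>}"]
        abs_triangle_ineq[of "cell True False \<omega> - joint_prob M Y0 Y1 True False"
          "cell True True \<omega> - joint_prob M Y0 Y1 True True"]
        abs_triangle_ineq[of "cell False True \<omega> - joint_prob M Y0 Y1 False True"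
          "cell True True \<omega> - joint_prob M Y0 Y1 True True"]
      unfolding S_def s_def d_def elim m0 m1 by (simp add: algebra_simps)
  qed
  have int: "integrable M (\<lambda>\<omega>. S \<omega> - s)"
    by (rule Bochner_Integration.integrable_bound[where f = "\<lambda>\<omega>. d True False \<omega> + d False True \<omega> + 2 * d True True \<omega>"])
      (use bound in auto)
  \<comment> \<open>Adding \<open>s\<close> back gives integrability of \<open>S\<close>, which
    linearity of the expectation requires in the next step.\<close>
  then have "integrable M (\<lambda>\<omega>. (S \<omega> - s) + s)"
    by (intro Bochner_Integration.integrable_add) auto
  then have "\<bar>expectation S - s\<bar> = \<bar>expectation (\<lambda>\<omega>. S \<omega> - s)\<bar>"
    by (simp add: prob_space)
  also have "\<dots> \<le> expectation (\<lambda>\<omega>. \<bar>S \<omega> - s\<bar>)"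
    by (rule integral_abs_bound)
  also have "\<dots> \<le> expectation (\<lambda>\<omega>. d True False \<omega> + d False True \<omega> + 2 * d True True \<omega>)"
    by (rule integral_mono_AE) (use bound int in auto)
  also have "\<dots> \<le> 4 * r"
    using d_le[of True False] d_le[of False True] d_le[of True True] by simp
  finally show ?thesis unfolding S_def s_def r_def .
qed

lemma uplift_frechet_lower_gap:
  assumes "b > 1"
  shows "\<bar>uplift_lower_bound M N X Y0 Y1 y0 y1 - frechet_lower_bound M Y0 Y1 y0 y1\<bar>
    \<le> 4 * sqrt (4 * ((outcome_entropy b M Y0 Y1 - outcome_cond_entropy b M N X f Y0 Y1) * ln b))"
  unfolding uplift_lower_bound_def frechet_lower_bound_def
  by (rule expectation_lipschitz_gap[OF assms]) (rule frechet_lower_measurable frechet_lower_lipschitz)+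

lemma uplift_frechet_upper_gap:
  assumes "b > 1"
  shows "\<bar>uplift_upper_bound M N X Y0 Y1 y0 y1 - frechet_upper_bound M Y0 Y1 y0 y1\<bar>
    \<le> 4 * sqrt (4 * ((outcome_entropy b M Y0 Y1 - outcome_cond_entropy b M N X f Y0 Y1) * ln b))"
  unfolding uplift_upper_bound_def frechet_upper_bound_def
  by (rule expectation_lipschitz_gap[OF assms]) (rule frechet_upper_measurable frechet_upper_lipschitz)+

end

section \<open>Passage to the limit\<close>

text \<open>An entropy "approaching" a value is read along an arbitrary filter on a family of
  models. The target probabilities and bounds vary with the model too, so differences are shown to
  tend to 0. The squeeze works because the gap estimates have constants depending only on
  \<open>b\<close>.\<close>

theorem theorem1:
  fixes M :: "'i \<Rightarrow> 'a measure" and N :: "'i \<Rightarrow> 'x measure"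
    and X :: "'i \<Rightarrow> 'a \<Rightarrow> 'x" and f :: "'i \<Rightarrow> 'x \<Rightarrow> real"
    and T Y Y0 Y1 :: "'i \<Rightarrow> 'a \<Rightarrow> bool"
    and F :: "'i filter" and b :: real and y0 y1 :: bool
  assumes "b > 1"
    and "\<And>i. uplift_model (M i) (N i) (X i) (f i) (T i) (Y i) (Y0 i) (Y1 i)"
  shows
    "(((\<lambda>i. outcome_cond_entropy b (M i) (N i) (X i) (f i) (Y0 i) (Y1 i)) \<longlongrightarrow> 0) F
      \<longrightarrow> ((\<lambda>i. uplift_lower_bound (M i) (N i) (X i) (Y0 i) (Y1 i) y0 y1
                 - joint_prob (M i) (Y0 i) (Y1 i) y0 y1) \<longlongrightarrow> 0) F
        \<and> ((\<lambda>i. uplift_upper_bound (M i) (N i) (X i) (Y0 i) (Y1 i) y0 y1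
                 - joint_prob (M i) (Y0 i) (Y1 i) y0 y1) \<longlongrightarrow> 0) F)
     \<and>
     (((\<lambda>i. outcome_cond_entropy b (M i) (N i) (X i) (f i) (Y0 i) (Y1 i)
            - outcome_entropy b (M i) (Y0 i) (Y1 i)) \<longlongrightarrow> 0) F
      \<longrightarrow> ((\<lambda>i. uplift_lower_bound (M i) (N i) (X i) (Y0 i) (Y1 i) y0 y1
                 - frechet_lower_bound (M i) (Y0 i) (Y1 i) y0 y1) \<longlongrightarrow> 0) F
        \<and> ((\<lambda>i. uplift_upper_bound (M i) (N i) (X i) (Y0 i) (Y1 i) y0 y1
                 - frechet_upper_bound (M i) (Y0 i) (Y1 i) y0 y1) \<longlongrightarrow> 0) F)"
proof (intro conjI impI)
  let ?c = "\<lambda>i. outcome_cond_entropy b (M i) (N i) (X i) (f i) (Y0 i) (Y1 i)"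
  let ?h = "\<lambda>i. outcome_entropy b (M i) (Y0 i) (Y1 i)"
  note model = assms(2) and b = assms(1)
  {
    assume "(?c \<longlongrightarrow> 0) F"
    then have lim: "((\<lambda>i. ?c i * (ln b / ln 2)) \<longlongrightarrow> 0) F"
      by (rule tendsto_mult_left_zero)
    show "((\<lambda>i. uplift_lower_bound (M i) (N i) (X i) (Y0 i) (Y1 i) y0 y1
        - joint_prob (M i) (Y0 i) (Y1 i) y0 y1) \<longlongrightarrow> 0) F"
      by (rule Lim_null_comparison[OF always_eventually lim])
        (simp only: real_norm_def uplift_model.uplift_lower_gap[OF model b] simp_thms)
    show "((\<lambda>i. uplift_upper_bound (M i) (N i) (X i) (Y0 i) (Y1 i) y0 y1
        - joint_prob (M i) (Y0 i) (Y1 i) y0 y1) \<longlongrightarrow> 0) F"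
      by (rule Lim_null_comparison[OF always_eventually lim])
        (simp only: real_norm_def uplift_model.uplift_upper_gap[OF model b] simp_thms)
  next
    assume "((\<lambda>i. ?c i - ?h i) \<longlongrightarrow> 0) F"
    \<comment> \<open>The assumption concerns \<open>?c i - ?h i\<close>, the gap estimate its
      negative; continuity of the square root carries the limit through.\<close>
    then have "((\<lambda>i. 4 * sqrt (4 * (- (?c i - ?h i) * ln b))) \<longlongrightarrow> 4 * sqrt (4 * (- 0 * ln b))) F"
      by (intro tendsto_intros)
    then have lim: "((\<lambda>i. 4 * sqrt (4 * ((?h i - ?c i) * ln b))) \<longlongrightarrow> 0) F"
      by simp
    show "((\<lambda>i. uplift_lower_bound (M i) (N i) (X i) (Y0 i) (Y1 i) y0 y1
        - frechet_lower_bound (M i) (Y0 i) (Y1 i) y0 y1) \<longlongrightarrow> 0) F"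
      by (rule Lim_null_comparison[OF always_eventually lim])
        (simp only: real_norm_def uplift_model.uplift_frechet_lower_gap[OF model b] simp_thms)
    show "((\<lambda>i. uplift_upper_bound (M i) (N i) (X i) (Y0 i) (Y1 i) y0 y1
        - frechet_upper_bound (M i) (Y0 i) (Y1 i) y0 y1) \<longlongrightarrow> 0) F"
      by (rule Lim_null_comparison[OF always_eventually lim])
        (simp only: real_norm_def uplift_model.uplift_frechet_upper_gap[OF model b] simp_thms)
  }
qed

end
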